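(* Let $m\ge1$, $t^0\in\mathbb{R}$, $s^0=0$, $\widetilde\eta>0$, $\mu\in\mathbb{R}$, $h=2\widetilde\eta$. Let $f:\mathbb{R}\times\mathbb{R}^m\times\mathbb{R}^m\to\mathbb{R}^m$ and $G:\mathbb{R}^m\to\mathbb{R}$ be Lipschitz with $|G(y)|\le\mu\widetilde\eta<\frac12$ for all $y\in\mathbb{R}^m$. Let $(y,\eta)$ be the solution of the state-dependent delay system with data $g\in C^1([t^0-h,t^0];\mathbb{R}^m)$, $\eta^0\in(0,2\widetilde\eta]$, let $\omega$ be an admissible initial time function for $\eta^0$, and let $\alpha$ be the associated time transformation. Assume that there is $h_1\in(0,\widetilde\eta]$ with $\eta(t)\ge h_1$ for all $t\ge t^0$. Then for all $s\ge0$ $$(\alpha(0)-h_1)+\frac{h_1}{h}\,s\ \le\ \alpha(s)\ \le\ (\alpha(0)+h)+s ,$$ and consequently "$s$-time" and "$t$-time" are equivalent: with $t=\alpha(s)$, $s\ge 0$, one has $A^1t+B^1\le s\le A^2t+B^2$ with $A^1=1$, $B^1=-(\alpha(0)+h)$, $A^2=\frac{h}{h_1}$, $B^2=-\frac{h}{h_1}(\alpha(0)-h_1)$.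
   Context: State-dependent delay system. For $(g,\eta^0)$ consider $$\dot y(t)=f(t,y(t),y(t-\eta(t))),\qquad \dot\eta(t)=-\mu(\eta(t)-\widetilde\eta)+G(y(t)),\qquad t>t^0,$$ with $y(t)=g(t)$ for $t\in[t^0-h,t^0]$ and $\eta(t^0)=\eta^0$. A solution is a pair of continuous functions $y:[t^0-h,\infty)\to\mathbb{R}^m$, $\eta:[t^0,\infty)\to\mathbb{R}$, satisfying the initial conditions, $C^1$ on $[t^0,\infty)$ (one-sided derivative at $t^0$) and satisfying the equations. Under the stated hypotheses it exists, is unique, satisfies $\eta(t)\in[0,2\widetilde\eta]$ for all $t\ge t^0$, and the deviating argument $\sigma(t)=t-\eta(t)$ satisfies $\dot\sigma(t)>0$ for $t\ge t^0$. Admissible initial time function for $\eta^0$: a $C^1$ function $\omega:[s^0-h,s^0]\to\mathbb{R}$ with $\dot\omega>0$, $\omega(s^0)=t^0$ and $\omega(s^0-h)=t^0-\eta^0<t^0$. Time transformation: $\alpha:[s^0-h,\infty)\to\mathbb{R}$ is defined by $\alpha(s)=\omega(s)$ on $[s^0-h,s^0]$ and, step by step on intervals of length $h$, $\alpha(s)=\sigma^{-1}(\alpha(s-h))$ for $s\ge s^0$. Equivalence of times: "$s$-time" and "$t$-time" are called equivalent if there are constants $A^1>0$, $A^2>0$, $B^1,B^2\in\mathbb{R}$ such that $A^1t+B^1\le s\le A^2t+B^2$, where $t=\alpha(s)$. *)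

theory Defs
  imports "HOL-Analysis.Analysis"
begin

text \<open>
  Derivatives are taken within the set, so they are one-sided at the end points of an interval;
  the library's \<open>C1_differentiable_on\<close> asks for two-sided derivatives there.
\<close>

definition C1_on :: "real set \<Rightarrow> (real \<Rightarrow> 'a::real_normed_vector) \<Rightarrow> bool" where
  "C1_on S u \<longleftrightarrow>
     (\<exists>u'. continuous_on S u' \<and> (\<forall>x\<in>S. (u has_vector_derivative u' x) (at x within S)))"

text \<open>
  \<open>d\<close> stands for eta-tilde.  The functions are total, but only
  \<open>y\<close> on \<open>{t0 - h..}\<close> and \<open>\<eta>\<close> on \<open>{t0..}\<close> are meaningful.
\<close>

definition delay_solution ::
  "real \<Rightarrow> real \<Rightarrow> real \<Rightarrow> real
   \<Rightarrow> (real \<times> (real ^ 'm) \<times> (real ^ 'm) \<Rightarrow> real ^ 'm) \<Rightarrow> (real ^ 'm \<Rightarrow> real)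
   \<Rightarrow> (real \<Rightarrow> real ^ 'm) \<Rightarrow> real \<Rightarrow> (real \<Rightarrow> real ^ 'm) \<Rightarrow> (real \<Rightarrow> real) \<Rightarrow> bool" where
  "delay_solution h t0 \<mu> d f G g \<eta>0 y \<eta> \<longleftrightarrow>
     continuous_on {t0 - h..} y \<and> continuous_on {t0..} \<eta> \<and>
     (\<forall>t\<in>{t0 - h..t0}. y t = g t) \<and> \<eta> t0 = \<eta>0 \<and>
     C1_on {t0..} y \<and> C1_on {t0..} \<eta> \<and>
     (\<forall>t>t0. (y has_vector_derivative f (t, y t, y (t - \<eta> t))) (at t)) \<and>
     (\<forall>t>t0. (\<eta> has_real_derivative (- \<mu> * (\<eta> t - d) + G (y t))) (at t))"

definition admissible_initial_time ::
  "real \<Rightarrow> real \<Rightarrow> real \<Rightarrow> real \<Rightarrow> (real \<Rightarrow> real) \<Rightarrow> bool" where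
  "admissible_initial_time h s0 t0 \<eta>0 \<omega> \<longleftrightarrow>
     (\<exists>\<omega>'. continuous_on {s0 - h..s0} \<omega>' \<and>
        (\<forall>s\<in>{s0 - h..s0}.
           (\<omega> has_real_derivative \<omega>' s) (at s within {s0 - h..s0}) \<and> \<omega>' s > 0)) \<and>
     \<omega> s0 = t0 \<and> \<omega> (s0 - h) = t0 - \<eta>0 \<and> t0 - \<eta>0 < t0"

definition deviating_argument :: "(real \<Rightarrow> real) \<Rightarrow> real \<Rightarrow> real" where
  "deviating_argument \<eta> t = t - \<eta> t"

text \<open>
  The inverse of the deviating argument is that of its restriction to \<open>{t0..}\<close>, where \<open>\<eta>\<close> is defined.
  The guard \<open>0 < h\<close> only serves termination.
\<close>

function time_transformation ::
  "real \<Rightarrow> real \<Rightarrow> real \<Rightarrow> (real \<Rightarrow> real) \<Rightarrow> (real \<Rightarrow> real) \<Rightarrow> real \<Rightarrow> real" where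
  "time_transformation h s0 t0 \<eta> \<omega> s =
     (if 0 < h \<and> s0 < s
      then inv_into {t0..} (deviating_argument \<eta>) (time_transformation h s0 t0 \<eta> \<omega> (s - h))
      else \<omega> s)"
  by auto
termination
proof (relation "Wellfounded.measure (\<lambda>(h, s0, t0, \<eta>, \<omega>, s). nat \<lceil>(s - s0) / h\<rceil>)", goal_cases)
  case 1
  then show ?case by simp
next
  case (2 h s0 t0 \<eta> \<omega> s)
  then have "(s - h - s0) / h = (s - s0) / h - 1" "(s - s0) / h > 0"
    by (simp_all add: field_simps)
  then show ?case by simp
qed

declare time_transformation.simps [simp del]

lemma time_transformation_initial:
  "s \<le> s0 \<Longrightarrow> time_transformation h s0 t0 \<eta> \<omega> s = \<omega> s"
  by (subst time_transformation.simps) simp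

text \<open>The recursion also holds at \<open>s = s0\<close>, where the two defining clauses overlap.\<close>

lemma time_transformation_step:
  assumes "0 < h" "s0 \<le> s" "admissible_initial_time h s0 t0 \<eta>0 \<omega>" "\<eta> t0 = \<eta>0"
    and "inj_on (deviating_argument \<eta>) {t0..}"
  shows "time_transformation h s0 t0 \<eta> \<omega> s =
    inv_into {t0..} (deviating_argument \<eta>) (time_transformation h s0 t0 \<eta> \<omega> (s - h))"
proof (cases "s = s0")
  case True
  have "inv_into {t0..} (deviating_argument \<eta>) (deviating_argument \<eta> t0) = t0"
    using assms(5) by (intro inv_into_f_f) auto
  then show ?thesis
    using True assms
    by (simp add: time_transformation_initial admissible_initial_time_def deviating_argument_def)
next
  case False
  then show ?thesis
    using assms(1,2) by (subst time_transformation.simps) simp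
qed

definition equivalent_times_with ::
  "real \<Rightarrow> (real \<Rightarrow> real) \<Rightarrow> real \<Rightarrow> real \<Rightarrow> real \<Rightarrow> real \<Rightarrow> bool" where
  "equivalent_times_with s0 \<alpha> A1 B1 A2 B2 \<longleftrightarrow>
     A1 > 0 \<and> A2 > 0 \<and> (\<forall>s\<ge>s0. A1 * \<alpha> s + B1 \<le> s \<and> s \<le> A2 * \<alpha> s + B2)"

definition equivalent_times :: "real \<Rightarrow> (real \<Rightarrow> real) \<Rightarrow> bool" where
  "equivalent_times s0 \<alpha> \<longleftrightarrow> (\<exists>A1 B1 A2 B2. equivalent_times_with s0 \<alpha> A1 B1 A2 B2)"

end

theory Submission
  imports Defs
begin

text \<open>
  By Gronwall's argument \<open>\<eta> \<le> 2 * d = h\<close>, so \<open>t - \<eta> t\<close> maps \<open>{t0..}\<close> onto \<open>{t0 - \<eta>0..}\<close> and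
  \<open>\<alpha> s - \<alpha> (s - h) = \<eta> (\<alpha> s)\<close> lies between \<open>h1\<close> and \<open>h\<close> for \<open>s > 0\<close>.
  Summing these increments over steps of length \<open>h\<close> gives both bounds.
\<close>

text \<open>Integrating factor: the differential inequality makes
  \<open>exp (k * t) * (u t - c)\<close> nonincreasing. It starts nonpositive, and the positive
  exponential leaves the sign of \<open>u t - c\<close> unchanged.\<close>

lemma gronwall_upper_barrier:
  fixes u u' :: "real \<Rightarrow> real"
  assumes "continuous_on {a..} u" "u a \<le> c" "a \<le> t"
    and "\<And>t. t > a \<Longrightarrow> (u has_real_derivative u' t) (at t)"
    and "\<And>t. t > a \<Longrightarrow> u' t \<le> - k * (u t - c)"
  shows "u t \<le> c"
proof -
  define v where "v = (\<lambda>t. exp (k * t) * (u t - c))"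
  have "v t \<le> v a"
  proof (rule DERIV_nonpos_imp_decreasing_open[OF \<open>a \<le> t\<close>])
    fix x assume "a < x" "x < t"
    have "(v has_real_derivative exp (k * x) * (k * (u x - c) + u' x)) (at x)"
      unfolding v_def by (rule derivative_eq_intros assms(4) \<open>a < x\<close> refl)+ (simp add: algebra_simps)
    moreover have "exp (k * x) * (k * (u x - c) + u' x) \<le> 0"
      using assms(5)[OF \<open>a < x\<close>] by (simp add: mult_le_0_iff)
    ultimately show "\<exists>D. (v has_real_derivative D) (at x) \<and> D \<le> 0"
      by blast
  next
    show "continuous_on {a..t} v"
      unfolding v_def
      by (intro continuous_intros continuous_on_subset[OF assms(1)]) auto
  qed
  moreover have "v a \<le> 0"
    using assms(2) by (simp add: v_def mult_le_0_iff)
  ultimately have "v t \<le> 0"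
    by simp
  then show ?thesis
    by (simp add: v_def mult_le_0_iff)
qed

text \<open>The bound \<open>G (y t) \<le> \<mu> * d\<close> turns the right-hand side into at most
  \<open>- \<mu> * (\<eta> t - 2 * d)\<close>, so the constant \<open>2 * d\<close> is a
  barrier.\<close>

lemma delay_solution_le:
  assumes "delay_solution h t0 \<mu> d f G g \<eta>0 y \<eta>" "\<And>x. \<bar>G x\<bar> \<le> \<mu> * d" "\<eta>0 \<le> 2 * d" "t0 \<le> t"
  shows "\<eta> t \<le> 2 * d"
proof (rule gronwall_upper_barrier[where u = \<eta> and u' = "\<lambda>t. - \<mu> * (\<eta> t - d) + G (y t)"])
  show "continuous_on {t0..} \<eta>" "\<eta> t0 \<le> 2 * d"
    using assms(1,3) by (auto simp: delay_solution_def)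
  show "(\<eta> has_real_derivative (- \<mu> * (\<eta> t - d) + G (y t))) (at t)" if "t0 < t" for t
    using assms(1) that unfolding delay_solution_def by blast
  show "- \<mu> * (\<eta> t - d) + G (y t) \<le> - \<mu> * (\<eta> t - 2 * d)" for t
    using assms(2)[of "y t"] by (simp add: algebra_simps)
qed (fact assms(4))

text \<open>Surjectivity is what makes \<open>inv_into\<close> return a genuine preimage; it comes
  from the intermediate value theorem.\<close>

lemma atLeast_subset_deviating_argument_image:
  assumes "continuous_on {a..} \<eta>" "\<And>t. t \<ge> a \<Longrightarrow> \<eta> t \<le> b"
  shows "{a - \<eta> a..} \<subseteq> deviating_argument \<eta> ` {a..}"
proof
  fix r assume "r \<in> {a - \<eta> a..}"
  \<comment> \<open>Since \<open>\<eta> \<le> b\<close>, the deviating argument has reached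
    \<open>r\<close> by time \<open>r + b\<close>; the maximum with \<open>a\<close> keeps the
    interval nonempty.\<close>
  have "\<exists>x. a \<le> x \<and> x \<le> max a (r + b) \<and> deviating_argument \<eta> x = r"
  proof (rule IVT')
    show "deviating_argument \<eta> a \<le> r"
      using \<open>r \<in> _\<close> by (simp add: deviating_argument_def)
    show "r \<le> deviating_argument \<eta> (max a (r + b))"
      using assms(2)[of "max a (r + b)"] by (simp add: deviating_argument_def)
    show "continuous_on {a..max a (r + b)} (deviating_argument \<eta>)"
      unfolding deviating_argument_def
      by (intro continuous_intros continuous_on_subset[OF assms(1)]) auto
  qed simp
  then show "r \<in> deviating_argument \<eta> ` {a..}"
    by auto
qed

lemma admissible_initial_time_bounds:
  assumes "admissible_initial_time h s0 t0 \<eta>0 \<omega>" "s0 - h \<le> s" "s \<le> s0"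
  shows "t0 - \<eta>0 \<le> \<omega> s" "\<omega> s \<le> t0"
proof -
  obtain \<omega>' where deriv: "\<And>s. s \<in> {s0 - h..s0} \<Longrightarrow>
      (\<omega> has_real_derivative \<omega>' s) (at s within {s0 - h..s0})"
    and pos: "\<And>s. s \<in> {s0 - h..s0} \<Longrightarrow> \<omega>' s > 0"
    using assms(1) unfolding admissible_initial_time_def by blast
  have mono: "\<omega> p \<le> \<omega> q" if "s0 - h \<le> p" "p \<le> q" "q \<le> s0" for p q
  proof (rule DERIV_nonneg_imp_increasing_open[OF \<open>p \<le> q\<close>])
    fix x assume "p < x" "x < q"
    then have "at x within {s0 - h..s0} = at x"
      using that by (intro at_within_Icc_at) auto
    then show "\<exists>D. (\<omega> has_real_derivative D) (at x) \<and> 0 \<le> D"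
      using deriv[of x] pos[of x] that \<open>p < x\<close> \<open>x < q\<close> by force
  next
    show "continuous_on {p..q} \<omega>"
      by (rule continuous_on_subset[OF DERIV_continuous_on[OF deriv]]) (use that in auto)
  qed
  show "t0 - \<eta>0 \<le> \<omega> s" "\<omega> s \<le> t0"
    using mono[of "s0 - h" s] mono[of s s0] assms by (auto simp: admissible_initial_time_def)
qed

text \<open>The method of steps as an induction rule: by the Archimedean property, finitely many
  shifts by \<open>h\<close> bring \<open>s\<close> back to the initial interval.\<close>

lemma delay_step_induct:
  fixes s s0 h :: real
  assumes "0 < h" "s0 - h \<le> s"
    and initial: "\<And>s. s0 - h \<le> s \<Longrightarrow> s \<le> s0 \<Longrightarrow> P s"
    and step: "\<And>s. s0 < s \<Longrightarrow> P (s - h) \<Longrightarrow> P s"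
  shows "P s"
proof -
  have "s0 - h \<le> s \<Longrightarrow> s \<le> s0 + real n * h \<Longrightarrow> P s" for n s
  proof (induction n arbitrary: s)
    case 0
    then show ?case by (simp add: initial)
  next
    case (Suc n)
    then show ?case
      using initial step Suc.IH[of "s - h"] by (cases "s \<le> s0") (auto simp: algebra_simps)
  qed
  moreover obtain n where "s - s0 < real n * h"
    using reals_Archimedean3[OF \<open>0 < h\<close>] by blast
  ultimately show ?thesis
    using assms(2) by (metis add.commute diff_less_eq order.strict_implies_order)
qed

lemma time_transformation_bounds:
  fixes h s0 t0 \<eta>0 :: real and \<eta> \<omega> :: "real \<Rightarrow> real"
  defines "\<alpha> \<equiv> time_transformation h s0 t0 \<eta> \<omega>"
  assumes "0 < h" "0 \<le> c" "admissible_initial_time h s0 t0 \<eta>0 \<omega>" "\<eta> t0 = \<eta>0"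
    and cont: "continuous_on {t0..} \<eta>"
    and le: "\<And>t. t \<ge> t0 \<Longrightarrow> \<eta> t \<le> h" and ge: "\<And>t. t \<ge> t0 \<Longrightarrow> c \<le> \<eta> t"
    and "s0 \<le> s"
  shows "t0 - c + c / h * (s - s0) \<le> \<alpha> s" "\<alpha> s \<le> t0 + h + (s - s0)"
proof -
  \<comment> \<open>The first conjunct keeps \<open>\<alpha> (s - h)\<close> in the range of the
    deviating argument. The linear lower bound is claimed only from \<open>s0\<close> on, since
    earlier \<alpha> may be as low as \<open>t0 - \<eta>0\<close>.\<close>
  have "t0 - \<eta>0 \<le> \<alpha> s \<and> \<alpha> s \<le> t0 + h + (s - s0) \<and>
      (s0 \<le> s \<longrightarrow> t0 \<le> \<alpha> s \<and> t0 - c + c / h * (s - s0) \<le> \<alpha> s)" (is "?P s")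
  proof (rule delay_step_induct[where P = ?P, OF \<open>0 < h\<close>])
    show "s0 - h \<le> s"
      using \<open>0 < h\<close> \<open>s0 \<le> s\<close> by simp
  next
    fix s assume 1: "s0 - h \<le> s" "s \<le> s0"
    then have "\<alpha> s = \<omega> s"
      by (simp add: \<alpha>_def time_transformation_initial)
    moreover have "\<omega> s0 = t0"
      using assms(4) by (simp add: admissible_initial_time_def)
    \<comment> \<open>Here \<open>s - s0 \<ge> - h\<close>, so the offset \<open>h\<close> in the
      upper bound leaves at least \<open>t0\<close>.\<close>
    ultimately show "?P s"
      using admissible_initial_time_bounds[OF assms(4) 1] 1 \<open>0 \<le> c\<close> by auto
  next
    fix s assume 2: "s0 < s" "?P (s - h)"
    have "\<alpha> s = inv_into {t0..} (deviating_argument \<eta>) (\<alpha> (s - h))"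
      using \<open>0 < h\<close> \<open>s0 < s\<close> unfolding \<alpha>_def by (subst time_transformation.simps) simp
    moreover have "\<alpha> (s - h) \<in> deviating_argument \<eta> ` {t0..}"
      using atLeast_subset_deviating_argument_image[OF cont le] 2 \<open>\<eta> t0 = \<eta>0\<close> by auto
    \<comment> \<open>Applying the deviating argument to the preimage \<open>\<alpha> s\<close>
      gives back \<open>\<alpha> (s - h)\<close>, so the increment over one step is exactly
      \<open>\<eta> (\<alpha> s)\<close>.\<close>
    ultimately have *: "t0 \<le> \<alpha> s" "\<alpha> s = \<alpha> (s - h) + \<eta> (\<alpha> s)"
      using inv_into_into[of "\<alpha> (s - h)" "deviating_argument \<eta>" "{t0..}"]
        f_inv_into_f[of "\<alpha> (s - h)" "deviating_argument \<eta>" "{t0..}"]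
      by (auto simp: deviating_argument_def)
    have "t0 - c + c / h * (s - s0) \<le> \<alpha> s"
    \<comment> \<open>In the first step \<open>\<alpha> s \<ge> t0\<close> suffices, because the
      linear term has grown by at most \<open>c\<close>; this is the source of the offset
      \<open>- c\<close>. Each later step adds at least \<open>c\<close> to \<alpha>, exactly the
      growth of the linear term.\<close>
    proof (cases "s - h \<le> s0")
      case True
      then have "c * (s - s0) \<le> c * h"
        using \<open>0 \<le> c\<close> by (intro mult_left_mono) auto
      then have "c / h * (s - s0) \<le> c"
        using \<open>0 < h\<close> by (simp add: field_simps)
      then show ?thesis
        using * by linarith
    next
      case False
      have "c / h * (s - s0) = c / h * (s - h - s0) + c"
        using \<open>0 < h\<close> by (simp add: field_simps)
      then show ?thesis
        using 2 False * ge[OF *(1)] by linarith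
    qed
    moreover have "0 \<le> \<eta>0"
      using ge[of t0] \<open>0 \<le> c\<close> \<open>\<eta> t0 = \<eta>0\<close> by simp
    \<comment> \<open>For the upper bound, \<alpha> grows by at most \<open>h\<close> while
      \<open>s\<close> grows by exactly \<open>h\<close>.\<close>
    ultimately show "?P s"
      using 2 * le[OF *(1)] by auto
  qed
  then show "t0 - c + c / h * (s - s0) \<le> \<alpha> s" "\<alpha> s \<le> t0 + h + (s - s0)"
    using \<open>s0 \<le> s\<close> by auto
qed

theorem mainTheorem4:
  fixes f :: "real \<times> (real ^ 'm) \<times> (real ^ 'm) \<Rightarrow> real ^ 'm"
    and G :: "real ^ 'm \<Rightarrow> real"
    and g y :: "real \<Rightarrow> real ^ 'm"
    and \<eta> \<omega> \<alpha> :: "real \<Rightarrow> real"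
    and t0 s0 d \<mu> h \<eta>0 h1 :: real
  assumes "s0 = 0" and "d > 0" and "h = 2 * d"
    and "\<exists>L. L-lipschitz_on UNIV f" and "\<exists>L. L-lipschitz_on UNIV G"
    and "\<And>x. \<bar>G x\<bar> \<le> \<mu> * d" and "\<mu> * d < 1 / 2"
    and "C1_on {t0 - h..t0} g" and "0 < \<eta>0" and "\<eta>0 \<le> 2 * d"
    and "delay_solution h t0 \<mu> d f G g \<eta>0 y \<eta>"
    and "admissible_initial_time h s0 t0 \<eta>0 \<omega>"
    and "\<alpha> = time_transformation h s0 t0 \<eta> \<omega>"
    and "0 < h1" and "h1 \<le> d" and "\<And>t. t \<ge> t0 \<Longrightarrow> h1 \<le> \<eta> t"
  shows "(\<forall>s\<ge>0. (\<alpha> 0 - h1) + h1 / h * s \<le> \<alpha> s \<and> \<alpha> s \<le> (\<alpha> 0 + h) + s) \<and>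
    equivalent_times_with s0 \<alpha> 1 (- (\<alpha> 0 + h)) (h / h1) (- (h / h1) * (\<alpha> 0 - h1)) \<and>
    equivalent_times s0 \<alpha>"
proof -
  have "0 < h"
    using assms(2,3) by simp
  have sol: "continuous_on {t0..} \<eta>" "\<eta> t0 = \<eta>0"
    using assms(11) by (auto simp: delay_solution_def)
  have "\<alpha> 0 = t0"
    using assms(1,12,13) by (simp add: time_transformation_initial admissible_initial_time_def)
  have le: "\<eta> t \<le> h" if "t0 \<le> t" for t
    using delay_solution_le[OF assms(11,6,10) that] assms(3) by simp
  have bounds: "(\<alpha> 0 - h1) + h1 / h * s \<le> \<alpha> s" "\<alpha> s \<le> (\<alpha> 0 + h) + s" if "0 \<le> s" for s
    using time_transformation_bounds[OF \<open>0 < h\<close> _ assms(12) sol(2,1) le assms(16), of s]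
      assms(1,13,14) that \<open>\<alpha> 0 = t0\<close> by auto
  \<comment> \<open>Solving the lower bound on \<open>\<alpha> s\<close> for \<open>s\<close> yields
    the constants \<open>A2\<close> and \<open>B2\<close>; the upper bound, rearranged, yields
    \<open>A1 = 1\<close> and \<open>B1\<close>.\<close>
  have "s \<le> h / h1 * \<alpha> s + - (h / h1) * (\<alpha> 0 - h1)" if "0 \<le> s" for s
  proof -
    have "s = h / h1 * (h1 / h * s)"
      using \<open>0 < h\<close> \<open>0 < h1\<close> by simp
    also have "\<dots> \<le> h / h1 * (\<alpha> s - (\<alpha> 0 - h1))"
      using bounds(1)[OF that] \<open>0 < h\<close> \<open>0 < h1\<close> by (intro mult_left_mono) auto
    finally show ?thesis
      by (simp add: right_diff_distrib)
  qed
  then have "equivalent_times_with s0 \<alpha> 1 (- (\<alpha> 0 + h)) (h / h1) (- (h / h1) * (\<alpha> 0 - h1))"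
    using bounds(2) \<open>0 < h\<close> \<open>0 < h1\<close> assms(1) by (fastforce simp: equivalent_times_with_def)
  then show ?thesis
    using bounds unfolding equivalent_times_def by blast
qed

end
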